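(* Let $X_1,X_2,\dots$ be i.i.d. from a fixed $P^*\in\mathcal P_{\theta^*}$, and let $(M_n^\theta)$ be e-values or an e-process testing the null $\theta$, for each $\theta\in\Theta$. Suppose there exist $N_0\ge1$ and, for each $n$, a function $D_n:[0,\infty)\times[0,1)\to\mathbb R$, possibly depending on both $P^*$ and the data $X_1,\dots,X_n$, such that for every $\delta\in[0,1)$ the function $D_n(\cdot,\delta)$ is strictly increasing and has an inverse $\varphi_n(\cdot,\delta)$, in the sense that $\varphi_n(h,\delta)\ge0$ and $D_n(\varphi_n(h,\delta),\delta)=h$ for all $h>0$, and such that for all $n\ge N_0$, $$P^*\big\{\forall\theta\in\Theta,\ \log M_n^\theta\ge D_n(|\theta-\theta^*|,\delta)\big\}\ge1-\delta\qquad\text{for all }\delta\in[0,1).$$ Let $\mathrm{CI}_n^\alpha=\{\theta\in\Theta:\log M_n^\theta\le\log(1/\alpha)\}$ and let $\tilde\theta_n^{(E)}\in\arg\min_{\theta\in\Theta}M_n^\theta$ be any ME-estimator. Then, for all $n\ge N_0$, $\alpha\in(0,1)$ and $\delta\in[0,1)$, $$P^*\{\operatorname{diam}(\mathrm{CI}_n^\alpha)\le2\varphi_n(\log(1/\alpha),\delta)\}\ge1-\delta,$$ $$P^*\{|\tilde\theta_n^{(E)}-\theta^*|\le\varphi_n(\log(1/\alpha),\delta)\}\ge1-\delta-\alpha.$$ Moreover, for arbitrary $\varepsilon>0$, $$\tilde\theta_n^{(E)}=\theta^*+\mathcal O_{a.s.}\big(\varphi_n((1+\varepsilon)\log n,\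 n^{-1-\varepsilon})\big),$$ that is, $P^*$-almost surely there is a finite (random) constant $C$ such that $|\tilde\theta_n^{(E)}-\theta^*|\le C\,\varphi_n((1+\varepsilon)\log n,n^{-1-\varepsilon})$ for all sufficiently large $n$.
   Context: $\Theta$ is a parameter space, with the distance between $\theta,\theta'$ written $|\theta-\theta'|$; $\operatorname{diam}(I)=\sup_{\theta,\theta'\in I}|\theta-\theta'|$, with the diameter of the empty set equal to $0$. For each $\theta\in\Theta$, $\mathcal P_\theta$ is a set of data-generating distributions; $\mathbb E_\theta$ in a statement means that the statement holds under i.i.d. data from every $P\in\mathcal P_\theta$. The data are i.i.d. from an unknown $P^*\in\mathcal P_{\theta^*}$, $\theta^*\in\Theta$; $P^*(\cdot)$ also denotes probability under this i.i.d. law. A statistic $M_n^\theta$ of $X_1,\dots,X_n$ is an e-value under $\theta$ (testing the null $\theta$) if $M_n^\theta\ge0$ and $\mathbb E_\theta M_n^\theta\le1$; the sequence $(M_n^\theta)_n$ of nonnegative statistics is an e-process under $\theta$ if $\mathbb E_\theta M_\tau^\theta\le1$ for any stopping time $\tau$ of the data filtration (so in particular each $M_n^\theta$ is an e-value). An ME-estimator is any element of $\arg\min_{\theta\in\Theta}M_n^\theta$, which is assumed nonempty (ties broken arbitrarily). Convention $\log0=-\infty$. All events in question are assumed measurable. *)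

theory Defs
  imports "HOL-Probability.Probability"
begin

text \<open>
  Data sequences are functions \<open>\<omega> :: nat \<Rightarrow> 'x\<close> with \<open>\<omega> i\<close> playing the role of \<open>X\<^sub>i\<^sub>+\<^sub>1\<close>, so that
  \<open>X\<^sub>1, \<dots>, X\<^sub>n\<close> are the coordinates \<open>i < n\<close>. The measurable space of a single observation is \<open>S\<close>.
\<close>

definition iid_law :: "'x measure \<Rightarrow> (nat \<Rightarrow> 'x) measure" where
  "iid_law P = PiM UNIV (\<lambda>_. P)"

abbreviation data_space :: "'x measure \<Rightarrow> (nat \<Rightarrow> 'x) set" where
  "data_space S \<equiv> space (PiM UNIV (\<lambda>_. S))"

definition data_filtration :: "'x measure \<Rightarrow> nat \<Rightarrow> (nat \<Rightarrow> 'x) measure" where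
  "data_filtration S n =
     vimage_algebra (data_space S) (\<lambda>\<omega>. restrict \<omega> {..<n}) (PiM {..<n} (\<lambda>_. S))"

definition nonneg_statistic :: "'x measure \<Rightarrow> nat \<Rightarrow> ((nat \<Rightarrow> 'x) \<Rightarrow> real) \<Rightarrow> bool" where
  "nonneg_statistic S n f \<longleftrightarrow>
     f \<in> borel_measurable (data_filtration S n) \<and> (\<forall>\<omega>\<in>data_space S. 0 \<le> f \<omega>)"

text \<open>
  In the next two definitions \<open>Q\<close> is the set of data-generating distributions of the null
  hypothesis. Expectations of nonnegative statistics are Lebesgue integrals in \<open>[0, \<infinity>]\<close>, so the
  bound by \<open>1\<close> includes integrability.
\<close>

definition e_value ::
  "'x measure \<Rightarrow> 'x measure set \<Rightarrow> nat \<Rightarrow> ((nat \<Rightarrow> 'x) \<Rightarrow> real) \<Rightarrow> bool" where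
  "e_value S Q n f \<longleftrightarrow>
     nonneg_statistic S n f \<and> (\<forall>P\<in>Q. (\<integral>\<^sup>+\<omega>. ennreal (f \<omega>) \<partial>iid_law P) \<le> 1)"

text \<open>
  The sequence starts at \<open>n = 1\<close>, so stopping times take values in \<open>{1, 2, \<dots>}\<close>. Finite stopping
  times suffice: stopping at \<open>min \<tau> N\<close> and letting \<open>N \<rightarrow> \<infinity>\<close> bounds the expectation of
  \<open>M\<^sub>\<tau>\<close> on \<open>{\<tau> < \<infinity>}\<close> for every extended stopping time \<open>\<tau>\<close>.
\<close>

definition e_process ::
  "'x measure \<Rightarrow> 'x measure set \<Rightarrow> (nat \<Rightarrow> (nat \<Rightarrow> 'x) \<Rightarrow> real) \<Rightarrow> bool" where
  "e_process S Q M \<longleftrightarrow>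
     (\<forall>n\<ge>1. nonneg_statistic S n (M n)) \<and>
     (\<forall>\<tau>. stopping_time (data_filtration S) \<tau> \<and> (\<forall>\<omega>\<in>data_space S. 1 \<le> \<tau> \<omega>) \<longrightarrow>
        (\<forall>P\<in>Q. (\<integral>\<^sup>+\<omega>. ennreal (M (\<tau> \<omega>) \<omega>) \<partial>iid_law P) \<le> 1))"

text \<open>Logarithm of a nonnegative real with \<open>log 0 = -\<infinity>\<close>; the library has \<open>ln 0 = 0\<close>.\<close>

definition elog :: "real \<Rightarrow> ereal" where
  "elog x = (if x \<le> 0 then -\<infinity> else ereal (ln x))"

text \<open>
  The library's real-valued \<open>diameter\<close> is unspecified on unbounded sets, where the supremum
  is \<open>\<infinity>\<close>.
\<close>

definition ediam :: "'t::metric_space set \<Rightarrow> ereal" where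
  "ediam I = (if I = {} then 0 else SUP (x, y)\<in>I \<times> I. ereal (dist x y))"

definition conf_set ::
  "'t set \<Rightarrow> ('t \<Rightarrow> nat \<Rightarrow> (nat \<Rightarrow> 'x) \<Rightarrow> real) \<Rightarrow> nat \<Rightarrow> real \<Rightarrow> (nat \<Rightarrow> 'x) \<Rightarrow> 't set" where
  "conf_set \<Theta> M n \<alpha> \<omega> = {\<theta>\<in>\<Theta>. elog (M \<theta> n \<omega>) \<le> ereal (ln (1 / \<alpha>))}"

end

theory Submission
  imports Defs
begin

text \<open>
  On the good event \<open>\<forall>\<theta>. log M\<^sub>n\<^sup>\<theta> \<ge> D\<^sub>n(|\<theta> - \<theta>\<^sup>*|, \<delta>)\<close>, monotonicity of \<open>D\<^sub>n\<close> puts the whole confidence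
  set inside the ball of radius \<open>\<phi>\<^sub>n(log(1/\<alpha>), \<delta>)\<close> around \<open>\<theta>\<^sup>*\<close>. If moreover \<open>\<theta>\<^sup>*\<close> lies in the
  confidence set, which fails with probability at most \<open>\<alpha>\<close> by Markov's inequality, then so does
  every minimiser of \<open>M\<^sub>n\<close>. The almost sure rate is the Borel--Cantelli lemma for
  \<open>\<alpha> = \<delta> = n powr (- 1 - \<epsilon>)\<close>, and the constant \<open>C = 1\<close> suffices.
\<close>

text \<open>The time-\<open>n\<close> sigma-algebra is generated by restriction to the first
  \<open>n\<close> coordinates. That map is measurable on the full product, so preimages of
  measurable sets under it stay measurable there.\<close>

lemma data_filtration_measurableD:
  assumes "f \<in> measurable (data_filtration S n) N"
    and "\<And>\<omega>. \<omega> \<in> data_space S \<Longrightarrow> f \<omega> \<in> space N"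
  shows "f \<in> measurable (PiM UNIV (\<lambda>_. S)) N"
proof (rule measurableI)
  fix A assume "A \<in> sets N"
  then have "f -` A \<inter> data_space S \<in> sets (data_filtration S n)"
    using measurable_sets[OF assms(1)] by (simp add: data_filtration_def)
  then obtain B where B: "B \<in> sets (PiM {..<n} (\<lambda>_. S))"
    "f -` A \<inter> data_space S = (\<lambda>\<omega>. restrict \<omega> {..<n}) -` B \<inter> data_space S"
    unfolding data_filtration_def
    by (subst (asm) sets_vimage_algebra2) (auto simp: space_PiM PiE_def)
  have "(\<lambda>\<omega>. restrict \<omega> {..<n}) \<in> measurable (PiM UNIV (\<lambda>_. S)) (PiM {..<n} (\<lambda>_. S))"
    by (rule measurable_restrict_subset) simp
  then show "f -` A \<inter> data_space S \<in> sets (PiM UNIV (\<lambda>_. S))"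
    using B by (metis measurable_sets)
qed (use assms in auto)

text \<open>The constant \<open>n\<close> is a stopping time, admissible because
  \<open>n \<ge> 1\<close>. This reduces both alternatives in the hypothesis on \<open>M\<close> to
  e-values at a fixed time.\<close>

lemma e_process_imp_e_value:
  assumes "e_process S Q M" "n \<ge> 1"
  shows "e_value S Q n (M n)"
proof -
  have st: "stopping_time (data_filtration S) (\<lambda>_. n)"
    by (rule stopping_timeI) simp
  have nn: "nonneg_statistic S n (M n)"
    using assms by (simp add: e_process_def)
  have "\<forall>P\<in>Q. (\<integral>\<^sup>+\<omega>. ennreal (M (\<tau> \<omega>) \<omega>) \<partial>iid_law P) \<le> 1"
    if "stopping_time (data_filtration S) \<tau>" "\<forall>\<omega>\<in>data_space S. 1 \<le> \<tau> \<omega>" for \<tau>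
    using assms(1) that unfolding e_process_def by blast
  from this[of "\<lambda>_. n"] have "\<forall>P\<in>Q. (\<integral>\<^sup>+\<omega>. ennreal (M n \<omega>) \<partial>iid_law P) \<le> 1"
    using st assms(2) by simp
  with nn show ?thesis
    by (simp add: e_value_def)
qed

lemma prob_space_iid_law: "prob_space P \<Longrightarrow> prob_space (iid_law P)"
  unfolding iid_law_def by (rule prob_space_PiM)

lemma sets_iid_law: "sets P = sets S \<Longrightarrow> sets (iid_law P) = sets (PiM UNIV (\<lambda>_. S))"
  unfolding iid_law_def by (rule sets_PiM_cong) auto

lemma space_iid_law: "sets P = sets S \<Longrightarrow> space (iid_law P) = data_space S"
  by (rule sets_eq_imp_space_eq) (rule sets_iid_law)

lemma e_value_measurable:
  assumes "e_value S Q n f" "sets P = sets S"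
  shows "f \<in> borel_measurable (iid_law P)"
proof -
  have "f \<in> borel_measurable (PiM UNIV (\<lambda>_. S))"
    using assms(1) unfolding e_value_def nonneg_statistic_def
    by (intro data_filtration_measurableD[of f S n]) auto
  then show ?thesis
    by (simp add: measurable_cong_sets[OF sets_iid_law[OF assms(2)] refl])
qed

text \<open>Markov's inequality for an expectation of at most 1 under the null. The strict
  inequality makes the event the exact complement of
  \<open>f \<omega> \<le> 1 / \<alpha>\<close>.\<close>

lemma e_value_Markov:
  assumes ev: "e_value S Q n f" and P: "P \<in> Q" "prob_space P" "sets P = sets S"
    and \<alpha>: "\<alpha> > 0"
  shows "measure (iid_law P) {\<omega>\<in>data_space S. f \<omega> > 1 / \<alpha>} \<le> \<alpha>"
proof -
  interpret prob_space "iid_law P" using P(2) by (rule prob_space_iid_law)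
  have [measurable]: "f \<in> borel_measurable (iid_law P)"
    by (rule e_value_measurable[OF ev P(3)])
  have sp: "space (iid_law P) = data_space S" by (rule space_iid_law[OF P(3)])
  \<comment> \<open>The event is enlarged to \<open>1 \<le> \<alpha> * f \<omega>\<close>, the form
    in which Markov's inequality applies to integrals with values in \<open>ennreal\<close>.\<close>
  have "emeasure (iid_law P) {\<omega>\<in>data_space S. f \<omega> > 1 / \<alpha>}
      \<le> emeasure (iid_law P) ({\<omega>\<in>space (iid_law P). 1 \<le> ennreal \<alpha> * ennreal (f \<omega>)})"
  proof (rule emeasure_mono)
    show "{\<omega>\<in>data_space S. f \<omega> > 1 / \<alpha>} \<subseteq> {\<omega>\<in>space (iid_law P). 1 \<le> ennreal \<alpha> * ennreal (f \<omega>)}"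
    proof (intro Collect_mono conj_mono impI)
      fix \<omega> assume "f \<omega> > 1 / \<alpha>"
      then have "1 \<le> \<alpha> * f \<omega>" using \<alpha> by (simp add: field_simps)
      then have "ennreal 1 \<le> ennreal (\<alpha> * f \<omega>)" by (rule ennreal_leI)
      then show "1 \<le> ennreal \<alpha> * ennreal (f \<omega>)" using \<alpha> by (simp add: ennreal_mult')
    qed (simp add: sp)
  qed measurable
  also have "\<dots> \<le> ennreal \<alpha> * (\<integral>\<^sup>+\<omega>\<in>space (iid_law P). ennreal (f \<omega>) \<partial>iid_law P)"
    using nn_integral_Markov_inequality[of "\<lambda>\<omega>. ennreal (f \<omega>)" "space (iid_law P)" "iid_law P" "ennreal \<alpha>"]
    by simp
  also have "\<dots> = ennreal \<alpha> * (\<integral>\<^sup>+\<omega>. ennreal (f \<omega>) \<partial>iid_law P)"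
    by (intro arg_cong2[where f="(*)"] nn_integral_cong refl) simp
  also have "\<dots> \<le> ennreal \<alpha> * 1"
    using ev P(1) unfolding e_value_def by (intro mult_left_mono) auto
  finally show ?thesis
    using \<alpha> by (simp add: emeasure_eq_measure)
qed

lemma elog_le_ln: "x \<le> y \<Longrightarrow> y > 0 \<Longrightarrow> elog x \<le> ereal (ln y)"
  by (auto simp: elog_def)

text \<open>If \<open>p < r\<close>, strict monotonicity would give \<open>h = g p < g r\<close>,
  whereas \<open>g r \<le> h\<close> follows through \<open>e\<close>. The intermediate
  \<open>e\<close> is an extended real because it stands for a value of \<open>elog\<close>.\<close>

lemma strict_mono_on_inverse_bound:
  fixes g :: "real \<Rightarrow> real"
  assumes "strict_mono_on {0..} g" "r \<ge> 0" "p \<ge> 0" "g p = h" "ereal (g r) \<le> e" "e \<le> ereal h"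
  shows "r \<le> p"
proof (rule ccontr)
  assume "\<not> r \<le> p"
  then have "g p < g r" using assms by (auto simp: strict_mono_on_def)
  moreover have "g r \<le> h" using assms(5,6) order_trans by fastforce
  ultimately show False using assms(4) by simp
qed

text \<open>Triangle inequality through the centre \<open>z\<close>. The condition
  \<open>r \<ge> 0\<close> covers the empty set, whose diameter is 0.\<close>

lemma ediam_le:
  assumes "\<And>x. x \<in> I \<Longrightarrow> dist x z \<le> r" "r \<ge> 0"
  shows "ediam I \<le> ereal (2 * r)"
proof -
  have "dist x y \<le> 2 * r" if "x \<in> I" "y \<in> I" for x y
    using assms(1)[OF that(1)] assms(1)[OF that(2)] dist_triangle2[of x y z] by simp
  then show ?thesis
    using assms(2) by (auto simp: ediam_def intro!: SUP_least)
qed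

theorem theorem2p7:
  fixes S :: "'x measure"
    and \<Theta> :: "'t::metric_space set"
    and \<P> :: "'t \<Rightarrow> 'x measure set"
    and Pstar :: "'x measure"
    and \<theta>star :: 't
    and M :: "'t \<Rightarrow> nat \<Rightarrow> (nat \<Rightarrow> 'x) \<Rightarrow> real"
    and N0 :: nat
    and D \<phi> :: "nat \<Rightarrow> (nat \<Rightarrow> 'x) \<Rightarrow> real \<Rightarrow> real \<Rightarrow> real"
    and est :: "nat \<Rightarrow> (nat \<Rightarrow> 'x) \<Rightarrow> 't"
  assumes model: "\<forall>\<theta>\<in>\<Theta>. \<forall>P\<in>\<P> \<theta>. prob_space P \<and> sets P = sets S"
    and truth: "\<theta>star \<in> \<Theta>" "Pstar \<in> \<P> \<theta>star"
    and evalues: "\<forall>\<theta>\<in>\<Theta>. (\<forall>n\<ge>1. e_value S (\<P> \<theta>) n (M \<theta> n)) \<or> e_process S (\<P> \<theta>) (M \<theta>)"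
    and N0: "N0 \<ge> 1"
    and D_data: "\<forall>n\<ge>1. \<forall>\<omega>\<in>data_space S. \<forall>\<omega>'\<in>data_space S. (\<forall>i<n. \<omega> i = \<omega>' i) \<longrightarrow>
        (\<forall>r\<ge>0. \<forall>\<delta>\<in>{0..<1}. D n \<omega> r \<delta> = D n \<omega>' r \<delta>)"
    and D_mono: "\<forall>n\<ge>1. \<forall>\<omega>\<in>data_space S. \<forall>\<delta>\<in>{0..<1}. strict_mono_on {0..} (\<lambda>r. D n \<omega> r \<delta>)"
    and D_inv: "\<forall>n\<ge>1. \<forall>\<omega>\<in>data_space S. \<forall>\<delta>\<in>{0..<1}. \<forall>h>0.
        \<phi> n \<omega> h \<delta> \<ge> 0 \<and> D n \<omega> (\<phi> n \<omega> h \<delta>) \<delta> = h"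
    and D_bound: "\<forall>n\<ge>N0. \<forall>\<delta>\<in>{0..<1}.
        measure (iid_law Pstar)
          {\<omega>\<in>data_space S. \<forall>\<theta>\<in>\<Theta>. elog (M \<theta> n \<omega>) \<ge> ereal (D n \<omega> (dist \<theta> \<theta>star) \<delta>)} \<ge> 1 - \<delta>"
    and est: "\<forall>n\<ge>1. \<forall>\<omega>\<in>data_space S. is_arg_min (\<lambda>\<theta>. M \<theta> n \<omega>) (\<lambda>\<theta>. \<theta> \<in> \<Theta>) (est n \<omega>)"
    and meas_D: "\<forall>n\<ge>N0. \<forall>\<delta>\<in>{0..<1}.
        {\<omega>\<in>data_space S. \<forall>\<theta>\<in>\<Theta>. elog (M \<theta> n \<omega>) \<ge> ereal (D n \<omega> (dist \<theta> \<theta>star) \<delta>)}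
          \<in> sets (iid_law Pstar)"
    and meas_diam: "\<forall>n\<ge>N0. \<forall>\<alpha>\<in>{0<..<1}. \<forall>\<delta>\<in>{0..<1}.
        {\<omega>\<in>data_space S. ediam (conf_set \<Theta> M n \<alpha> \<omega>) \<le> ereal (2 * \<phi> n \<omega> (ln (1 / \<alpha>)) \<delta>)}
          \<in> sets (iid_law Pstar)"
    and meas_est: "\<forall>n\<ge>N0. \<forall>\<alpha>\<in>{0<..<1}. \<forall>\<delta>\<in>{0..<1}.
        {\<omega>\<in>data_space S. dist (est n \<omega>) \<theta>star \<le> \<phi> n \<omega> (ln (1 / \<alpha>)) \<delta>}
          \<in> sets (iid_law Pstar)"
  shows "(\<forall>n\<ge>N0. \<forall>\<alpha>\<in>{0<..<1}. \<forall>\<delta>\<in>{0..<1}.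
      measure (iid_law Pstar)
        {\<omega>\<in>data_space S. ediam (conf_set \<Theta> M n \<alpha> \<omega>) \<le> ereal (2 * \<phi> n \<omega> (ln (1 / \<alpha>)) \<delta>)} \<ge> 1 - \<delta> \<and>
      measure (iid_law Pstar)
        {\<omega>\<in>data_space S. dist (est n \<omega>) \<theta>star \<le> \<phi> n \<omega> (ln (1 / \<alpha>)) \<delta>} \<ge> 1 - \<delta> - \<alpha>) \<and>
    (\<forall>\<epsilon>>0. AE \<omega> in iid_law Pstar. \<exists>C::real. \<forall>\<^sub>F n in sequentially.
      dist (est n \<omega>) \<theta>star \<le> C * \<phi> n \<omega> ((1 + \<epsilon>) * ln (real n)) (real n powr (- 1 - \<epsilon>)))"
proof -
  have P: "prob_space Pstar" "sets Pstar = sets S"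
    using model truth by auto
  interpret prob_space "iid_law Pstar" using P(1) by (rule prob_space_iid_law)
  let ?G = "\<lambda>n \<delta>. {\<omega>\<in>data_space S. \<forall>\<theta>\<in>\<Theta>. elog (M \<theta> n \<omega>) \<ge> ereal (D n \<omega> (dist \<theta> \<theta>star) \<delta>)}"
  let ?F = "\<lambda>n \<alpha> \<delta>. {\<omega>\<in>data_space S. ediam (conf_set \<Theta> M n \<alpha> \<omega>)
    \<le> ereal (2 * \<phi> n \<omega> (ln (1 / \<alpha>)) \<delta>)}"
  let ?E = "\<lambda>n \<alpha> \<delta>. {\<omega>\<in>data_space S. dist (est n \<omega>) \<theta>star \<le> \<phi> n \<omega> (ln (1 / \<alpha>)) \<delta>}"
  have sp: "space (iid_law Pstar) = data_space S" by (rule space_iid_law[OF P(2)])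
  have ball: "dist \<theta> \<theta>star \<le> \<phi> n \<omega> (ln (1 / \<alpha>)) \<delta>"
    if "n \<ge> N0" "\<alpha> \<in> {0<..<1}" "\<delta> \<in> {0..<1}" "\<omega> \<in> ?G n \<delta>" "\<theta> \<in> conf_set \<Theta> M n \<alpha> \<omega>" for n \<alpha> \<delta> \<omega> \<theta>
  proof -
    \<comment> \<open>Since \<open>\<alpha> < 1\<close>, the level \<open>ln (1 / \<alpha>)\<close>
      is positive, as \<open>D_inv\<close> demands.\<close>
    have n: "n \<ge> 1" and h: "ln (1 / \<alpha>) > 0" using that(1,2) N0 by auto
    have \<phi>: "\<phi> n \<omega> (ln (1 / \<alpha>)) \<delta> \<ge> 0" "D n \<omega> (\<phi> n \<omega> (ln (1 / \<alpha>)) \<delta>) \<delta> = ln (1 / \<alpha>)"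
      using D_inv n h that(3,4) by auto
    have mono: "strict_mono_on {0..} (\<lambda>r. D n \<omega> r \<delta>)"
      using D_mono n that(3,4) by auto
    have \<theta>: "\<theta> \<in> \<Theta>" "elog (M \<theta> n \<omega>) \<le> ereal (ln (1 / \<alpha>))"
      using that(5) by (simp_all add: conf_set_def)
    from \<theta>(1) have "ereal (D n \<omega> (dist \<theta> \<theta>star) \<delta>) \<le> elog (M \<theta> n \<omega>)"
      using that(4) by blast
    then show ?thesis
      by (rule strict_mono_on_inverse_bound[OF mono zero_le_dist \<phi> _ \<theta>(2)])
  qed
  have diam: "prob (?F n \<alpha> \<delta>) \<ge> 1 - \<delta>"
    if n: "n \<ge> N0" and \<alpha>: "\<alpha> \<in> {0<..<1}" and \<delta>: "\<delta> \<in> {0..<1}" for n \<alpha> \<delta>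
  proof -
    have "1 - \<delta> \<le> prob (?G n \<delta>)" using D_bound n \<delta> by blast
    also have "\<dots> \<le> prob (?F n \<alpha> \<delta>)"
    proof (rule finite_measure_mono)
      show "?G n \<delta> \<subseteq> ?F n \<alpha> \<delta>"
      proof
        fix \<omega> assume \<omega>: "\<omega> \<in> ?G n \<delta>"
        \<comment> \<open>The confidence set may be empty here, so the radius must be known to be
          nonnegative. Coverage of \<open>\<theta>star\<close> is not at stake, hence no loss of
          \<open>\<alpha>\<close> in this bound.\<close>
        have "\<phi> n \<omega> (ln (1 / \<alpha>)) \<delta> \<ge> 0" using D_inv n N0 \<alpha> \<delta> \<omega> by auto
        then show "\<omega> \<in> ?F n \<alpha> \<delta>"
          using ediam_le[OF ball[OF n \<alpha> \<delta> \<omega>]] \<omega> by auto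
      qed
    qed (use meas_diam n \<alpha> \<delta> in blast)
    finally show ?thesis .
  qed
  have estim: "prob (?E n \<alpha> \<delta>) \<ge> 1 - \<delta> - \<alpha>"
    if n: "n \<ge> N0" and \<alpha>: "\<alpha> \<in> {0<..<1}" and \<delta>: "\<delta> \<in> {0..<1}" for n \<alpha> \<delta>
  proof -
    \<comment> \<open>The event that the confidence set misses \<open>\<theta>star\<close>,
      expressed through \<open>M\<close> itself so that Markov's inequality bounds it by
      \<open>\<alpha>\<close>. The good event is then covered by \<open>?E\<close> and
      \<open>?B\<close>, and a union bound finishes.\<close>
    let ?B = "{\<omega>\<in>data_space S. M \<theta>star n \<omega> > 1 / \<alpha>}"
    have n1: "n \<ge> 1" using n N0 by simp
    have ev: "e_value S (\<P> \<theta>star) n (M \<theta>star n)"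
      using evalues truth(1) n1 e_process_imp_e_value by blast
    have [measurable]: "M \<theta>star n \<in> borel_measurable (iid_law Pstar)"
      by (rule e_value_measurable[OF ev P(2)])
    have B: "?B \<in> events" unfolding sp[symmetric] by measurable
    have E: "?E n \<alpha> \<delta> \<in> events" using meas_est n \<alpha> \<delta> by blast
    have "?G n \<delta> \<subseteq> ?E n \<alpha> \<delta> \<union> ?B"
    proof
      fix \<omega> assume \<omega>: "\<omega> \<in> ?G n \<delta>"
      have am: "is_arg_min (\<lambda>\<theta>. M \<theta> n \<omega>) (\<lambda>\<theta>. \<theta> \<in> \<Theta>) (est n \<omega>)" using est n1 \<omega> by blast
      show "\<omega> \<in> ?E n \<alpha> \<delta> \<union> ?B"
      proof (cases "M \<theta>star n \<omega> \<le> 1 / \<alpha>")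
        case True
        \<comment> \<open>The minimal value is at most the value at \<open>\<theta>star\<close>.
          Should it be 0, its \<open>elog\<close> is minus infinity, and the estimator still belongs
          to the confidence set.\<close>
        have "M (est n \<omega>) n \<omega> \<le> 1 / \<alpha>"
          using am truth(1) True by (force simp: is_arg_min_linorder)
        then have "est n \<omega> \<in> conf_set \<Theta> M n \<alpha> \<omega>"
          using am \<alpha> unfolding conf_set_def is_arg_min_def by (auto intro!: elog_le_ln)
        then show ?thesis using ball[OF n \<alpha> \<delta> \<omega>] \<omega> by auto
      qed (use \<omega> in auto)
    qed
    then have "prob (?G n \<delta>) \<le> prob (?E n \<alpha> \<delta> \<union> ?B)"
      using B E by (intro finite_measure_mono) auto
    also have "\<dots> \<le> prob (?E n \<alpha> \<delta>) + prob ?B"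
      by (rule measure_Un_le[OF E B])
    also have "prob ?B \<le> \<alpha>"
      using e_value_Markov[OF ev truth(2) P] \<alpha> by simp
    finally show ?thesis
      using D_bound n \<delta> by force
  qed
  have rate: "AE \<omega> in iid_law Pstar. \<exists>C::real. \<forall>\<^sub>F n in sequentially.
      dist (est n \<omega>) \<theta>star \<le> C * \<phi> n \<omega> ((1 + \<epsilon>) * ln (real n)) (real n powr (- 1 - \<epsilon>))"
    if \<epsilon>: "\<epsilon> > 0" for \<epsilon> :: real
  proof -
    \<comment> \<open>\<open>a n\<close> serves as both \<open>\<alpha>\<close> and
      \<open>\<delta>\<close>, so that \<open>ln (1 / a n)\<close> is the level in the claimed rate.
      Starting at \<open>m \<ge> 2\<close> keeps \<open>a n\<close> strictly between 0 and 1, which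
      fails at \<open>n = 0\<close> and \<open>n = 1\<close>.\<close>
    define a where "a n = real n powr (- 1 - \<epsilon>)" for n
    define m where "m = max 2 N0"
    \<comment> \<open>The failure event of the estimator bound, set to be empty below
      \<open>m\<close> so that the probability estimate holds for every \<open>n\<close>.\<close>
    define A where "A n = (if n \<ge> m then space (iid_law Pstar) - ?E n (a n) (a n) else {})" for n
    have a: "0 < a n" "a n < 1" if "n \<ge> m" for n
      using that \<epsilon> by (auto simp: a_def m_def powr_less_one)
    have ln_a: "ln (1 / a n) = (1 + \<epsilon>) * ln (real n)" if "n \<ge> m" for n
      using that by (auto simp: a_def m_def ln_div ln_powr algebra_simps)
    have E: "?E n (a n) (a n) \<in> events" if "n \<ge> m" for n
      using meas_est a[OF that] that by (auto simp: m_def)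
    have A: "A n \<in> events" for n
      using E[of n] by (auto simp: A_def)
    \<comment> \<open>The factor 2 is the sum of the two error levels \<open>\<delta>\<close> and
      \<open>\<alpha>\<close>, both equal to \<open>a n\<close>.\<close>
    have "prob (A n) \<le> 2 * a n" for n
    proof (cases "n \<ge> m")
      case True
      then have "prob (A n) = 1 - prob (?E n (a n) (a n))"
        using prob_compl[OF E[OF True]] by (simp add: A_def)
      then show ?thesis
        using estim[of n "a n" "a n"] a[OF True] True by (auto simp: m_def)
    qed (simp add: A_def a_def)
    moreover have "summable (\<lambda>n. 2 * a n)"
      \<comment> \<open>The exponent \<open>- 1 - \<epsilon>\<close> lies below -1, which is exactly
        the condition for summability.\<close>
      using \<epsilon> unfolding a_def by (intro summable_mult) (simp add: summable_real_powr_iff)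
    ultimately have "summable (\<lambda>n. prob (A n))"
      by (intro summable_comparison_test[of "\<lambda>n. prob (A n)" "\<lambda>n. 2 * a n"]) auto
    then have "AE \<omega> in iid_law Pstar. \<forall>\<^sub>F n in sequentially. \<omega> \<in> space (iid_law Pstar) - A n"
      by (intro borel_cantelli_AE1 A) (auto simp: emeasure_eq_measure)
    then show ?thesis
    proof (rule AE_mp, intro AE_I2 impI exI[of _ 1])
      fix \<omega> assume "\<forall>\<^sub>F n in sequentially. \<omega> \<in> space (iid_law Pstar) - A n"
      then show "\<forall>\<^sub>F n in sequentially. dist (est n \<omega>) \<theta>star
          \<le> 1 * \<phi> n \<omega> ((1 + \<epsilon>) * ln (real n)) (real n powr (- 1 - \<epsilon>))"
        \<comment> \<open>From \<open>m\<close> on, lying outside \<open>A n\<close> means lying in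
          \<open>?E n (a n) (a n)\<close>.\<close>
        using eventually_ge_at_top[of m]
      proof eventually_elim
        case (elim n)
        then have "\<omega> \<in> ?E n (a n) (a n)" by (simp add: A_def)
        then show ?case using ln_a[OF elim(2)] by (simp add: a_def)
      qed
    qed
  qed
  show ?thesis using diam estim rate by blast
qed

end
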